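(* Let $G$ be a finite abelian group consisting of $b$ elements. Let $P\subseteq\mathbb{X}_n^s$ be a subgroup of size $b^m$. For $X\in\mathbb{X}_n^s$, let $x_i\in\mathbb{X}_n$ be its $i$-th row, namely $X=(x_1,\ldots,x_s)^\top$. Then $P$ is a strict digital $(t,m,s)$-net over $G$ with $$t=(1-s)(m+1)+\deg\Bigg(-\Big(1+(b-1)z+\cdots+(b^m-b^{m-1})z^m-b^mz^{m+1}\Big)^s+b^{sm-m}\sum_{X\in P}z^{(m+1)s}\prod_{i=1}^s\big(z^{-\nu^*(x_i)}-1\big)\Bigg),$$ where $\nu^*(x_i)=\mu^*(x_i)$ for $x_i\neq0$ and $\nu^*(0)=m+1$.
   Context: Here $b\ge2$, $s,m\ge1$ and $n\ge m$ are integers, and $\deg$ denotes the degree in the variable $z$. $\mathbb{X}_n:=G^n$, and $\mathbb{X}_n^s$ is identified with the additive group of $s\times n$ matrices $X=(\xi_{i,j})$ over $G$. For $x=(\xi_1,\ldots,\xi_n)\in\mathbb{X}_n$ with $x\neq0$, $\mu^*(x)=\min\{j:\xi_j\neq0\}$ is the index of the first nonzero coordinate. Nets: a point set of $b^m$ points in $[0,1)^s$ is a $(t,m,s)$-net in base $b$ if for all nonnegative integers $d_1,\ldots,d_s$ with $d_1+\cdots+d_s=m-t$ and all integers $0\le a_i<b^{d_i}$, the interval $\prod_{i=1}^s[a_ib^{-d_i},(a_i+1)b^{-d_i})$ contains exactly $b^t$ of the points. Fix a bijection $\varphi:\{0,\ldots,b-1\}\to G$ with $\varphi(0)=0$; it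 induces the injection $\varphi^{-1}:\mathbb{X}_n^s\to[0,1)^s$ sending $X$ to the point with $i$-th coordinate $\sum_{j=1}^n\varphi^{-1}(\xi_{i,j})b^{-j}$. A subset $P\subset\mathbb{X}_n^s$ is a $(t,m,s)$-net in base $b$ if $\varphi^{-1}(P)$ is; it is strict if $t$ is the smallest value for which this holds. A net arising from a subgroup $P$ of $\mathbb{X}_n^s$ is called a digital net over $G$. *)

theory Defs
  imports
    Complex_Main
    "HOL-Algebra.Product_Groups"
    "HOL-Computational_Algebra.Formal_Laurent_Series"
begin

text \<open>Groups follow the HOL-Algebra convention and are written multiplicatively, so the zero
  element of the abelian group \<open>G\<close> appears as \<open>\<one>\<^bsub>G\<^esub>\<close>.  All coordinates
  are indexed from 1.\<close>

definition row_group :: "('g, 'r) monoid_scheme \<Rightarrow> nat \<Rightarrow> (nat \<Rightarrow> 'g) monoid" where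
  "row_group G n = product_group {1..n} (\<lambda>_. G)"

definition matrix_group ::
    "('g, 'r) monoid_scheme \<Rightarrow> nat \<Rightarrow> nat \<Rightarrow> (nat \<Rightarrow> nat \<Rightarrow> 'g) monoid" where
  "matrix_group G s n = product_group {1..s} (\<lambda>_. row_group G n)"

text \<open>Meaningful only for \<open>x\<close> different from the identity of \<open>row_group G n\<close>.\<close>

definition mu_star :: "('g, 'r) monoid_scheme \<Rightarrow> nat \<Rightarrow> (nat \<Rightarrow> 'g) \<Rightarrow> nat" where
  "mu_star G n x = Min {j \<in> {1..n}. x j \<noteq> \<one>\<^bsub>G\<^esub>}"

definition nu_star :: "('g, 'r) monoid_scheme \<Rightarrow> nat \<Rightarrow> nat \<Rightarrow> (nat \<Rightarrow> 'g) \<Rightarrow> nat" where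
  "nu_star G n m x = (if x = \<one>\<^bsub>row_group G n\<^esub> then m + 1 else mu_star G n x)"

definition elementary_interval ::
    "nat \<Rightarrow> nat \<Rightarrow> (nat \<Rightarrow> nat) \<Rightarrow> (nat \<Rightarrow> nat) \<Rightarrow> (nat \<Rightarrow> real) set" where
  "elementary_interval b s d a =
     (\<Pi>\<^sub>E i\<in>{1..s}. {real (a i) / real b ^ d i ..< (real (a i) + 1) / real b ^ d i})"

definition is_net :: "nat \<Rightarrow> nat \<Rightarrow> nat \<Rightarrow> nat \<Rightarrow> (nat \<Rightarrow> real) set \<Rightarrow> bool" where
  "is_net b t m s Q \<longleftrightarrow>
     t \<le> m \<and>
     Q \<subseteq> (\<Pi>\<^sub>E i\<in>{1..s}. {0..<1}) \<and> finite Q \<and> card Q = b ^ m \<and>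
     (\<forall>d a. (\<Sum>i\<in>{1..s}. d i) = m - t \<and> (\<forall>i\<in>{1..s}. a i < b ^ d i) \<longrightarrow>
        card (Q \<inter> elementary_interval b s d a) = b ^ t)"

definition digit_point ::
    "(nat \<Rightarrow> 'g) \<Rightarrow> nat \<Rightarrow> nat \<Rightarrow> nat \<Rightarrow> (nat \<Rightarrow> nat \<Rightarrow> 'g) \<Rightarrow> nat \<Rightarrow> real" where
  "digit_point \<phi> b s n X =
     (\<lambda>i\<in>{1..s}. \<Sum>j=1..n. real (inv_into {..<b} \<phi> (X i j)) / real b ^ j)"

definition digital_net ::
    "('g, 'r) monoid_scheme \<Rightarrow> (nat \<Rightarrow> 'g) \<Rightarrow> nat \<Rightarrow> nat \<Rightarrow> nat \<Rightarrow> nat \<Rightarrow> nat \<Rightarrow>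
     (nat \<Rightarrow> nat \<Rightarrow> 'g) set \<Rightarrow> bool" where
  "digital_net G \<phi> b n t m s P \<longleftrightarrow>
     subgroup P (matrix_group G s n) \<and> is_net b t m s (digit_point \<phi> b s n ` P)"

definition strict_digital_net ::
    "('g, 'r) monoid_scheme \<Rightarrow> (nat \<Rightarrow> 'g) \<Rightarrow> nat \<Rightarrow> nat \<Rightarrow> nat \<Rightarrow> nat \<Rightarrow> nat \<Rightarrow>
     (nat \<Rightarrow> nat \<Rightarrow> 'g) set \<Rightarrow> bool" where
  "strict_digital_net G \<phi> b n t m s P \<longleftrightarrow>
     digital_net G \<phi> b n t m s P \<and> (\<forall>t'. digital_net G \<phi> b n t' m s P \<longrightarrow> t \<le> t')"

text \<open>Degree of a Laurent polynomial, i.e. of a formal Laurent series with finite support.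
  As for \<^const>\<open>Polynomial.degree\<close>, the zero polynomial has degree 0.\<close>

definition laurent_degree :: "'a::zero fls \<Rightarrow> int" where
  "laurent_degree f = (if f = 0 then 0 else Max {k. fls_nth f k \<noteq> 0})"

text \<open>If \<open>n > m + 1\<close>, the exponent \<open>(m + 1) * s - (\<Sum>i. \<nu>\<^sup>*(x\<^sub>i))\<close> can be negative,
  so the sum over \<open>P\<close> is in general a Laurent polynomial in \<open>z\<close> rather than a polynomial.\<close>

definition net_poly ::
    "('g, 'r) monoid_scheme \<Rightarrow> nat \<Rightarrow> nat \<Rightarrow> nat \<Rightarrow> nat \<Rightarrow> (nat \<Rightarrow> nat \<Rightarrow> 'g) set \<Rightarrow> int fls" where
  "net_poly G b n m s P =
     - ((1 + (\<Sum>k=1..m. (of_nat b ^ k - of_nat b ^ (k - 1)) * fls_X ^ k)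
           - of_nat b ^ m * fls_X ^ (m + 1)) ^ s)
     + of_nat b ^ (s * m - m) *
         (\<Sum>X\<in>P. fls_X ^ ((m + 1) * s) *
            (\<Prod>i=1..s. fls_X_intpow (- int (nu_star G n m (X i))) - 1))"

end

theory Submission
  imports Defs
begin

text \<open>Both \<open>1 + (b - 1) z + \<dots> - b^m z^(m+1) = (1 - z) \<Sum>\<^sub>e b^(m-e) z^(m-e)\<close> (over \<open>0 \<le> e \<le> m\<close>) and
  \<open>z^(m+1) (z^(-\<nu>) - 1) = (1 - z) \<Sum>\<^sub>e z^(m-e)\<close> (over \<open>0 \<le> e < \<nu>\<close>) contain the factor \<open>1 - z\<close>. Hence the
  Laurent polynomial is \<open>(1 - z)^s R\<close>, where the coefficient of \<open>z^(sm-k)\<close> in \<open>R\<close> is the sum over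
  all \<open>e\<close> with \<open>|e| = k\<close> of \<open>b^(sm-m) (N(e) - b^(m-k))\<close>, the term \<open>b^(m-k)\<close> being present only
  if all \<open>e\<^sub>i \<le> m\<close>, and \<open>N(e)\<close> counts the \<open>X \<in> P\<close> with \<open>\<nu>\<^sup>*(x\<^sub>i) > e\<^sub>i\<close> for all \<open>i\<close>.
  For \<open>k \<le> m\<close>, \<open>N(e)\<close> is the size of the kernel of the projection of \<open>P\<close> to the first \<open>e\<^sub>i\<close> entries of
  each row, so \<open>N(e) \<ge> b^(m-k)\<close> with equality iff the projection is onto, that is, iff every
  elementary interval of shape \<open>e\<close> contains \<open>b^(m-k)\<close> points. No cancellation is possible, and the
  degree of \<open>R\<close> is \<open>sm - k\<close> for the least \<open>k\<close> at which equidistribution fails. If it holds for all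
  \<open>k \<le> m\<close>, then the coefficient for \<open>k = m + 1\<close> is positive when \<open>s \<ge> 2\<close>, since \<open>N(e) \<ge> 1 > 1/b\<close>, while
  for \<open>s = 1\<close> the polynomial is 0 and so is \<open>t\<close>.\<close>

section \<open>Degrees of Laurent polynomials\<close>

text \<open>The support of \<open>f\<close> is bounded below by \<open>fls_subdegree f\<close>; the
  upper bound \<open>D\<close> makes it finite and \<open>Max\<close> meaningful.\<close>

lemma laurent_degree_eqI:
  assumes "fls_nth f D \<noteq> 0" and "\<And>k. k > D \<Longrightarrow> fls_nth f k = 0"
  shows "laurent_degree f = D"
proof -
  have "{k. fls_nth f k \<noteq> 0} \<subseteq> {fls_subdegree f..D}"
    using assms(2) fls_eq0_below_subdegree[of _ f] by (auto simp: not_less[symmetric])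
  then have "finite {k. fls_nth f k \<noteq> 0}"
    by (rule finite_subset) simp
  then have "Max {k. fls_nth f k \<noteq> 0} = D"
    using assms by (intro Max_eqI) (auto simp: not_less[symmetric])
  moreover have "f \<noteq> 0" using assms(1) by auto
  ultimately show ?thesis by (simp add: laurent_degree_def)
qed

text \<open>Each factor \<open>1 - fls_X\<close> subtracts the coefficient at \<open>k - 1\<close>
  from that at \<open>k\<close>, so the leading coefficient moves up one place and only changes its
  sign.\<close>

lemma one_minus_X_power_leading:
  fixes f :: "'a::comm_ring_1 fls"
  assumes "fls_nth f D \<noteq> 0" and "\<And>k. k > D \<Longrightarrow> fls_nth f k = 0"
  shows "fls_nth ((1 - fls_X) ^ s * f) (D + int s) \<noteq> 0 \<and>
         (\<forall>k > D + int s. fls_nth ((1 - fls_X) ^ s * f) k = 0)"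
proof (induction s)
  case 0
  show ?case using assms by simp
next
  case (Suc s)
  let ?g = "(1 - fls_X) ^ s * f"
  have "(1 - fls_X) ^ Suc s * f = ?g - fls_X * ?g"
    by (simp only: power_Suc mult.assoc left_diff_distrib mult_1_left)
  then have "fls_nth ((1 - fls_X) ^ Suc s * f) k = fls_nth ?g k - fls_nth ?g (k - 1)" for k
    by (simp only: fls_X_times_conv_shift(1)) simp
  then show ?case using Suc.IH by simp
qed

lemma laurent_degree_one_minus_X_power:
  fixes f :: "'a::comm_ring_1 fls"
  assumes "fls_nth f D \<noteq> 0" and "\<And>k. k > D \<Longrightarrow> fls_nth f k = 0"
  shows "laurent_degree ((1 - fls_X) ^ s * f) = D + int s"
  using one_minus_X_power_leading[OF assms] by (intro laurent_degree_eqI) auto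

section \<open>Extraction of the factor 1 - z and expansion of the products\<close>

lemma X_intpow_step:
  "fls_X_intpow (k + 1) = fls_X * (fls_X_intpow k :: 'a::comm_ring_1 fls)"
  by (simp add: fls_X_times_conv_shift)

lemma geometric_factor:
  fixes m :: nat
  shows "1 + (\<Sum>k=1..m. (of_nat b ^ k - of_nat b ^ (k - 1)) * fls_X ^ k) - of_nat b ^ m * fls_X ^ (m + 1)
    = (1 - fls_X) * (\<Sum>k\<le>m. (of_nat b :: 'a::comm_ring_1 fls) ^ k * fls_X ^ k)"
  by (induction m) (simp_all add: algebra_simps)

text \<open>Substituting k = m - e gives the sum the same shape as in \<open>nu_factor\<close>, so
  that one product expansion serves both. The \<open>if\<close> is essential: for e > m the
  truncated \<open>m - e\<close> would contribute b^0 = 1.\<close>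

lemma truncated_geometric_factor:
  assumes "m < M"
  shows "1 + (\<Sum>k=1..m. (of_nat b ^ k - of_nat b ^ (k - 1)) * fls_X ^ k) - of_nat b ^ m * fls_X ^ (m + 1)
    = (1 - fls_X) * (\<Sum>e<M. of_int (if e \<le> m then int b ^ (m - e) else 0)
        * (fls_X_intpow (int m - int e) :: 'a::comm_ring_1 fls))"
proof -
  have "(\<Sum>k\<le>m. (of_nat b :: 'a fls) ^ k * fls_X ^ k)
      = (\<Sum>e\<le>m. of_nat b ^ (m - e) * fls_X ^ (m - e))"
    by (rule sum.reindex_bij_witness[of _ "\<lambda>e. m - e" "\<lambda>e. m - e"]) auto
  also have "\<dots> = (\<Sum>e<M. of_int (if e \<le> m then int b ^ (m - e) else 0)
        * fls_X_intpow (int m - int e))"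
    using assms by (intro sum.mono_neutral_cong_left) (auto simp: fls_X_power_conv_shift_1 of_nat_diff)
  finally show ?thesis unfolding geometric_factor by simp
qed

text \<open>The sum over e < \<nu> telescopes. Its exponents m - e turn negative once \<nu> > m + 1,
  hence \<open>fls_X_intpow\<close>.\<close>

lemma nu_factor:
  assumes "\<nu> \<le> M"
  shows "fls_X ^ (m + 1) * (fls_X_intpow (- int \<nu>) - 1)
    = (1 - fls_X) * (\<Sum>e<M. of_int (of_bool (e < \<nu>))
        * (fls_X_intpow (int m - int e) :: 'a::comm_ring_1 fls))"
proof -
  have "(\<Sum>e<M. of_int (of_bool (e < \<nu>)) * fls_X_intpow (int m - int e))
      = (\<Sum>e<\<nu>. (fls_X_intpow (int m - int e) :: 'a fls))"
    using assms by (intro sum.mono_neutral_cong_right) auto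
  moreover have "fls_X ^ (m + 1) * (fls_X_intpow (- int \<nu>) - 1)
    = (1 - fls_X) * (\<Sum>e<\<nu>. (fls_X_intpow (int m - int e) :: 'a fls))"
  proof (induction \<nu>)
    case 0
    then show ?case by simp
  next
    case (Suc \<nu>)
    have "fls_X ^ (m + 1) * fls_X_intpow (- int k) = (fls_X_intpow (int m + 1 - int k) :: 'a fls)" for k
      by (simp only: fls_X_power_times_conv_shift) (simp add: algebra_simps)
    then have "fls_X ^ (m + 1) * (fls_X_intpow (- int (Suc \<nu>)) - 1)
      = fls_X ^ (m + 1) * (fls_X_intpow (- int \<nu>) - 1)
        + (fls_X_intpow (int m - int \<nu>) - (fls_X_intpow (int m - int \<nu> + 1) :: 'a fls))"
      by (simp only: right_diff_distrib) (simp add: algebra_simps)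
    then show ?case
      unfolding Suc.IH X_intpow_step by (simp add: algebra_simps)
  qed
  ultimately show ?thesis by simp
qed

lemma prod_X_intpow:
  "finite I \<Longrightarrow> (\<Prod>i\<in>I. (fls_X_intpow (k i) :: 'a::comm_ring_1 fls)) = fls_X_intpow (\<Sum>i\<in>I. k i)"
  by (induction I rule: finite_induct) (simp_all add: fls_X_intpow_times_conv_shift algebra_simps)

lemma prod_factors:
  fixes s m :: nat
  shows "(\<Prod>i=1..s. (1 - fls_X) * (\<Sum>e<M. of_int (c i e) * fls_X_intpow (int m - int e)))
    = (1 - fls_X) ^ s * (\<Sum>e\<in>{1..s} \<rightarrow>\<^sub>E {..<M}. of_int (\<Prod>i=1..s. c i (e i))
        * (fls_X_intpow (int (s * m) - int (\<Sum>i=1..s. e i)) :: 'a::comm_ring_1 fls))"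
proof -
  have "(\<Prod>i=1..s. (\<Sum>e<M. of_int (c i e) * (fls_X_intpow (int m - int e) :: 'a fls)))
    = (\<Sum>e\<in>{1..s} \<rightarrow>\<^sub>E {..<M}. (\<Prod>i=1..s. of_int (c i (e i)) * fls_X_intpow (int m - int (e i))))"
    by (rule prod_sum_PiE) auto
  also have "\<dots> = (\<Sum>e\<in>{1..s} \<rightarrow>\<^sub>E {..<M}. of_int (\<Prod>i=1..s. c i (e i))
        * fls_X_intpow (int (s * m) - int (\<Sum>i=1..s. e i)))"
    by (intro sum.cong refl)
      (simp only: prod.distrib of_int_prod prod_X_intpow finite_atLeastAtMost sum_subtractf sum_constant
         card_atLeastAtMost of_nat_sum of_nat_mult, simp)
  finally show ?thesis by (simp add: prod.distrib)
qed

lemma prod_truncated_power: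
  assumes "finite I"
  shows "(\<Prod>i\<in>I. if e i \<le> m then int b ^ (m - e i) else 0)
    = (if \<forall>i\<in>I. e i \<le> m then int b ^ (card I * m - (\<Sum>i\<in>I. e i)) else 0)"
proof (cases "\<forall>i\<in>I. e i \<le> m")
  case True
  then have "(\<Sum>i\<in>I. m - e i) = card I * m - (\<Sum>i\<in>I. e i)"
    by (subst sum_subtractf_nat) auto
  with True show ?thesis by (simp flip: power_sum)
next
  case False
  with assms show ?thesis by (auto intro: prod_zero)
qed

section \<open>Coefficients of the cofactor of (1 - z)^s\<close>

definition nu_count ::
    "('g, 'r) monoid_scheme \<Rightarrow> nat \<Rightarrow> nat \<Rightarrow> nat \<Rightarrow> (nat \<Rightarrow> nat \<Rightarrow> 'g) set \<Rightarrow> (nat \<Rightarrow> nat) \<Rightarrow> nat" where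
  "nu_count G n m s P e = card {X \<in> P. \<forall>i\<in>{1..s}. e i < nu_star G n m (X i)}"

text \<open>The subtracted term is \<open>b ^ (s * m - m)\<close> times \<open>b ^ (m - |e|)\<close>, the value of \<open>nu_count\<close> for an
  equidistributed \<open>P\<close>, with the exponents merged because \<open>|e| > m\<close> is possible.\<close>

definition excess ::
    "('g, 'r) monoid_scheme \<Rightarrow> nat \<Rightarrow> nat \<Rightarrow> nat \<Rightarrow> nat \<Rightarrow> (nat \<Rightarrow> nat \<Rightarrow> 'g) set \<Rightarrow> (nat \<Rightarrow> nat) \<Rightarrow> int" where
  "excess G b n m s P e = int b ^ (s * m - m) * int (nu_count G n m s P e)
     - (if \<forall>i\<in>{1..s}. e i \<le> m then int b ^ (s * m - (\<Sum>i=1..s. e i)) else 0)"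

text \<open>Both summands are expanded over the same index set by \<open>prod_factors\<close>. The
  bound \<open>M\<close> has to exceed \<open>m\<close> for a complete geometric sum, and must
  dominate every \<open>nu_star\<close> so that no index e < \<nu> is lost.\<close>

lemma net_poly_factor:
  assumes "finite P" and "m < M" and "\<And>X i. X \<in> P \<Longrightarrow> i \<in> {1..s} \<Longrightarrow> nu_star G n m (X i) \<le> M"
  shows "net_poly G b n m s P = (1 - fls_X) ^ s *
    (\<Sum>e\<in>{1..s} \<rightarrow>\<^sub>E {..<M}. of_int (excess G b n m s P e)
        * fls_X_intpow (int (s * m) - int (\<Sum>i=1..s. e i)))"
proof -
  let ?E = "{1..s} \<rightarrow>\<^sub>E {..<M}"
  let ?Z = "\<lambda>e. fls_X_intpow (int (s * m) - int (\<Sum>i=1..s. e i)) :: int fls"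
  let ?\<nu> = "\<lambda>X i. nu_star G n m (X i)"
  have 1: "(1 + (\<Sum>k=1..m. (of_nat b ^ k - of_nat b ^ (k - 1)) * fls_X ^ k)
           - of_nat b ^ m * fls_X ^ (m + 1)) ^ s
    = (1 - fls_X) ^ s * (\<Sum>e\<in>?E. of_int (if \<forall>i\<in>{1..s}. e i \<le> m then int b ^ (s * m - (\<Sum>i=1..s. e i)) else 0) * ?Z e)"
    (is "?A ^ s = _")
  proof -
    have "?A ^ s = (\<Prod>i=1..s. ?A)" by simp
    also have "\<dots> = (1 - fls_X) ^ s * (\<Sum>e\<in>?E. of_int (\<Prod>i=1..s. if e i \<le> m then int b ^ (m - e i) else 0) * ?Z e)"
      unfolding truncated_geometric_factor[OF assms(2)] by (rule prod_factors)
    finally show ?thesis unfolding prod_truncated_power[OF finite_atLeastAtMost] card_atLeastAtMost diff_Suc_1 .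
  qed
  have 2: "fls_X ^ ((m + 1) * s) * (\<Prod>i=1..s. fls_X_intpow (- int (?\<nu> X i)) - 1)
    = (1 - fls_X) ^ s * (\<Sum>e\<in>?E. of_int (of_bool (\<forall>i\<in>{1..s}. e i < ?\<nu> X i)) * ?Z e)" if "X \<in> P" for X
  proof -
    have "fls_X ^ ((m + 1) * s) * (\<Prod>i=1..s. fls_X_intpow (- int (?\<nu> X i)) - (1 :: int fls))
      = (\<Prod>i=1..s. fls_X ^ (m + 1) * (fls_X_intpow (- int (?\<nu> X i)) - 1))"
      unfolding prod.distrib power_mult by simp
    also have "\<dots> = (\<Prod>i=1..s. (1 - fls_X) * (\<Sum>e<M. of_int (of_bool (e < ?\<nu> X i))
        * (fls_X_intpow (int m - int e))))"
      using assms(3)[OF that] by (intro prod.cong refl nu_factor) auto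
    also have "\<dots> = (1 - fls_X) ^ s * (\<Sum>e\<in>?E. of_int (\<Prod>i=1..s. of_bool (e i < ?\<nu> X i)) * ?Z e)"
      by (rule prod_factors)
    also have "(\<lambda>e. \<Prod>i=1..s. of_bool (e i < ?\<nu> X i) :: int) = (\<lambda>e. of_bool (\<forall>i\<in>{1..s}. e i < ?\<nu> X i))"
      by (auto simp: of_bool_def fun_eq_iff intro: prod_zero)
    finally show ?thesis .
  qed
  have 3: "(\<Sum>X\<in>P. fls_X ^ ((m + 1) * s) * (\<Prod>i=1..s. fls_X_intpow (- int (?\<nu> X i)) - 1))
     = (1 - fls_X) ^ s * (\<Sum>e\<in>?E. of_int (int (nu_count G n m s P e)) * ?Z e)"
  proof -
    have "(\<Sum>X\<in>P. fls_X ^ ((m + 1) * s) * (\<Prod>i=1..s. fls_X_intpow (- int (?\<nu> X i)) - 1))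
      = (1 - fls_X) ^ s * (\<Sum>X\<in>P. \<Sum>e\<in>?E. of_int (of_bool (\<forall>i\<in>{1..s}. e i < ?\<nu> X i)) * ?Z e)"
      using 2 by (simp only: sum_distrib_left cong: sum.cong)
    \<comment> \<open>Interchanging the sums turns the indicators over \<open>P\<close> into the
      count N(e).\<close>
    also have "\<dots> = (1 - fls_X) ^ s * (\<Sum>e\<in>?E. of_int (\<Sum>X\<in>P. of_bool (\<forall>i\<in>{1..s}. e i < ?\<nu> X i)) * ?Z e)"
      by (subst sum.swap) (simp only: sum_distrib_right of_int_sum)
    also have "(\<lambda>e. \<Sum>X\<in>P. of_bool (\<forall>i\<in>{1..s}. e i < ?\<nu> X i) :: int) = (\<lambda>e. int (nu_count G n m s P e))"
      using assms(1) by (simp add: nu_count_def fun_eq_iff sum_of_bool_eq Int_def)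
    finally show ?thesis .
  qed
  show ?thesis
    unfolding net_poly_def 1 3 excess_def
    by (simp add: algebra_simps sum.distrib sum_subtractf sum_distrib_left of_int_diff)
qed

text \<open>Here \<open>k\<close> is an integer: for negative \<open>k\<close>, that is, at
  exponents above \<open>s * m\<close>, the right-hand sum is empty.\<close>

lemma net_poly_factor_nth:
  fixes M s m :: nat
  shows "fls_nth (\<Sum>e\<in>{1..s} \<rightarrow>\<^sub>E {..<M}. of_int (c e)
        * (fls_X_intpow (int (s * m) - int (\<Sum>i=1..s. e i)) :: int fls)) (int (s * m) - k)
    = (\<Sum>e | e \<in> {1..s} \<rightarrow>\<^sub>E {..<M} \<and> int (\<Sum>i=1..s. e i) = k. c e)"
proof -
  have "finite ({1..s} \<rightarrow>\<^sub>E {..<M})" by (intro finite_PiE) auto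
  then show ?thesis
    unfolding fls_nth_sum
    by (intro sum.mono_neutral_cong_right) auto
qed

section \<open>Leading digits\<close>

text \<open>Horner's scheme for the integer with base \<open>b\<close> digits \<open>c 1\<close>,
  ..., \<open>c d\<close>, so that induction on \<open>d\<close> appends a digit.\<close>

primrec leading_value :: "nat \<Rightarrow> (nat \<Rightarrow> nat) \<Rightarrow> nat \<Rightarrow> nat" where
  "leading_value b c 0 = 0"
| "leading_value b c (Suc d) = b * leading_value b c d + c (Suc d)"

lemma digit_step_le: "v < B \<Longrightarrow> c < b \<Longrightarrow> b * v + c < b * (B::nat)"
proof -
  assume "v < B" "c < b"
  then have "b * v + c < b * Suc v" by simp
  also have "\<dots> \<le> b * B" using \<open>v < B\<close> by (intro mult_le_mono2) simp
  finally show ?thesis .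
qed

lemma leading_value_less:
  "(\<And>j. j \<in> {1..d} \<Longrightarrow> c j < b) \<Longrightarrow> leading_value b c d < b ^ d"
  by (induction d) (simp_all add: digit_step_le)

lemma leading_value_eq_iff:
  assumes "\<And>j. j \<in> {1..d} \<Longrightarrow> c j < b" and "\<And>j. j \<in> {1..d} \<Longrightarrow> c' j < b"
  shows "leading_value b c d = leading_value b c' d \<longleftrightarrow> (\<forall>j\<in>{1..d}. c j = c' j)"
  using assms
proof (induction d)
  case 0
  then show ?case by simp
next
  case (Suc d)
  have *: "b * u + x = b * v + y \<longleftrightarrow> u = v \<and> x = y" if "x < b" "y < b" for u v x y :: nat
  proof
    assume "b * u + x = b * v + y"
    then have "(b * u + x) div b = (b * v + y) div b" "(b * u + x) mod b = (b * v + y) mod b"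
      by simp_all
    with that show "u = v \<and> x = y" by simp
  qed simp
  have "c (Suc d) < b" "c' (Suc d) < b" using Suc.prems by auto
  then show ?case
    using Suc by (simp add: * atLeastAtMostSuc_conv ball_conj_distrib conj_commute)
qed

lemma sum_digits_eq_leading_value:
  assumes "b > 0"
  shows "(\<Sum>j=1..n. real (c j) / real b ^ j) = real (leading_value b c n) / real b ^ n"
  using assms by (induction n) (simp_all add: field_simps)

text \<open>Each further digit multiplies the value by \<open>b\<close> and adds less than
  \<open>b\<close>, so \<open>k\<close> of them multiply by b^k and add less than b^k.\<close>

lemma leading_value_extend:
  assumes "\<And>j. j \<in> {1..d + k} \<Longrightarrow> c j < b"
  shows "b ^ k * leading_value b c d \<le> leading_value b c (d + k) \<and>
         leading_value b c (d + k) < b ^ k * (leading_value b c d + 1)"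
  using assms
proof (induction k)
  case 0
  then show ?case by simp
next
  case (Suc k)
  then have IH: "b ^ k * leading_value b c d \<le> leading_value b c (d + k)"
    "leading_value b c (d + k) < b ^ k * (leading_value b c d + 1)" and "c (Suc (d + k)) < b"
    by auto
  then show ?case
    using digit_step_le[OF IH(2), of "c (Suc (d + k))" b] trans_le_add1[OF mult_le_mono2[OF IH(1), of b]]
    by (simp add: algebra_simps)
qed

text \<open>After scaling by b^n everything is an integer. The sum lies in the interval of its own
  leading value, and intervals belonging to different \<open>a\<close> are disjoint.\<close>

lemma digit_sum_in_interval_iff:
  assumes "b > 0" and "d \<le> n" and "\<And>j. j \<in> {1..n} \<Longrightarrow> c j < b"
  shows "(\<Sum>j=1..n. real (c j) / real b ^ j) \<in> {real a / real b ^ d ..< (real a + 1) / real b ^ d}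
    \<longleftrightarrow> leading_value b c d = a"
proof -
  obtain k where n: "n = d + k" using assms(2) le_Suc_ex by blast
  let ?v = "leading_value b c d" and ?w = "leading_value b c n"
  have v: "b ^ k * ?v \<le> ?w" "?w < b ^ k * (?v + 1)"
    using leading_value_extend[of d k c b] assms(3) n by auto
  have "real a / real b ^ d \<le> real ?w / real b ^ n \<longleftrightarrow> real (b ^ k * a) \<le> real ?w"
    using assms(1) by (simp add: n field_simps power_add)
  moreover have "real ?w / real b ^ n < (real a + 1) / real b ^ d \<longleftrightarrow> real ?w < real (b ^ k * (a + 1))"
    using assms(1) by (simp add: n field_simps power_add)
  moreover have "b ^ k * a \<le> ?w \<and> ?w < b ^ k * (a + 1) \<longleftrightarrow> ?v = a"
  proof
    assume "b ^ k * a \<le> ?w \<and> ?w < b ^ k * (a + 1)"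
    then have "b ^ k * a < b ^ k * (?v + 1)" "b ^ k * ?v < b ^ k * (a + 1)"
      using v by linarith+
    then have "a < ?v + 1" "?v < a + 1" unfolding mult_less_cancel1 by auto
    then show "?v = a" by simp
  qed (use v in auto)
  ultimately show ?thesis
    unfolding sum_digits_eq_leading_value[OF assms(1)] by (simp only: atLeastLessThan_iff of_nat_le_iff of_nat_less_iff)
qed

text \<open>Left translation by \<open>inv z\<close> maps the fibre through \<open>z\<close> onto
  the fibre through \<open>\<one>\<close>. The condition on \<open>f\<close> says only that its
  fibres are cosets; it suits \<open>box d\<close>, whose values are tuples of integers.\<close>

lemma (in group) card_fibres:
  assumes H: "subgroup H G" "finite H"
    and f: "\<And>x y. x \<in> H \<Longrightarrow> y \<in> H \<Longrightarrow> f x = f y \<longleftrightarrow> f (inv x \<otimes> y) = f \<one>"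
  shows card_fibre: "\<And>y. y \<in> f ` H \<Longrightarrow> card {x \<in> H. f x = y} = card {x \<in> H. f x = f \<one>}"
    and card_fibres_mult: "card H = card (f ` H) * card {x \<in> H. f x = f \<one>}"
proof -
  have carr: "x \<in> carrier G" if "x \<in> H" for x
    using subgroup.subset[OF H(1)] that by blast
  show fibre: "card {x \<in> H. f x = y} = card {x \<in> H. f x = f \<one>}" if y: "y \<in> f ` H" for y
  proof -
    obtain z where z: "z \<in> H" "y = f z" using y by blast
    have cancel: "inv z \<otimes> (z \<otimes> x) = x" "z \<otimes> (inv z \<otimes> x) = x" if "x \<in> H" for x
      using carr[OF z(1)] carr[OF that] by (simp_all add: m_assoc[symmetric])
    have into: "f (inv z \<otimes> x) = f \<one>" if "x \<in> H" "f x = y" for x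
      using f[OF z(1) that(1)] that(2) z(2) by simp
    have outof: "f (z \<otimes> x) = y" if "x \<in> H" "f x = f \<one>" for x
    proof -
      have "z \<otimes> x \<in> H" using z(1) that(1) by (rule subgroup.m_closed[OF H(1)])
      from f[OF z(1) this] show ?thesis using that(2) z(2) cancel(1)[OF that(1)] by simp
    qed
    have "bij_betw (\<lambda>x. inv z \<otimes> x) {x \<in> H. f x = y} {x \<in> H. f x = f \<one>}"
      by (rule bij_betwI[where g = "\<lambda>x. z \<otimes> x"]) (use z(1) cancel into outof subgroup.m_closed[OF H(1)] subgroup.m_inv_closed[OF H(1)] in auto)
    then show ?thesis by (rule bij_betw_same_card)
  qed
  have "card H = (\<Sum>y\<in>f ` H. card {x \<in> H. f x = y})"
  proof -
    have "card H = card (\<Union>y\<in>f ` H. {x \<in> H. f x = y})" by (rule arg_cong[where f = card]) auto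
    also have "\<dots> = (\<Sum>y\<in>f ` H. card {x \<in> H. f x = y})"
      using H(2) by (intro card_UN_disjoint) auto
    finally show ?thesis .
  qed
  also have "\<dots> = (\<Sum>y\<in>f ` H. card {x \<in> H. f x = f \<one>})"
    by (intro sum.cong refl fibre)
  finally show "card H = card (f ` H) * card {x \<in> H. f x = f \<one>}" by simp
qed

section \<open>Initial zeros of a row and its \<open>nu_star\<close>\<close>

lemma nu_star_greaterD:
  assumes "e < nu_star G n m x" and "j \<in> {1..n}" and "j \<le> e"
  shows "x j = \<one>\<^bsub>G\<^esub>"
proof (rule ccontr)
  assume neq: "x j \<noteq> \<one>\<^bsub>G\<^esub>"
  then have "x \<noteq> \<one>\<^bsub>row_group G n\<^esub>" using assms(2) by (auto simp: row_group_def)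
  then have "e < Min {j \<in> {1..n}. x j \<noteq> \<one>\<^bsub>G\<^esub>}"
    using assms(1) by (simp add: nu_star_def mu_star_def)
  also have "\<dots> \<le> j" using neq assms(2) by (intro Min_le) auto
  finally show False using assms(3) by simp
qed

lemma row_eq_one_iff:
  assumes "x \<in> carrier (row_group G n)"
  shows "x = \<one>\<^bsub>row_group G n\<^esub> \<longleftrightarrow> (\<forall>j\<in>{1..n}. x j = \<one>\<^bsub>G\<^esub>)"
proof -
  have "x \<in> extensional {1..n}" using assms by (simp add: row_group_def PiE_def)
  then show ?thesis by (auto simp: row_group_def intro: extensionalityI[of _ "{1..n}"])
qed

lemma mu_star_mem:
  assumes "x \<in> carrier (row_group G n)" and "x \<noteq> \<one>\<^bsub>row_group G n\<^esub>"
  shows "mu_star G n x \<in> {1..n}" and "x (mu_star G n x) \<noteq> \<one>\<^bsub>G\<^esub>"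
proof -
  have "{j \<in> {1..n}. x j \<noteq> \<one>\<^bsub>G\<^esub>} \<noteq> {}"
    using assms row_eq_one_iff by fastforce
  then have "mu_star G n x \<in> {j \<in> {1..n}. x j \<noteq> \<one>\<^bsub>G\<^esub>}"
    unfolding mu_star_def by (intro Min_in) auto
  then show "mu_star G n x \<in> {1..n}" "x (mu_star G n x) \<noteq> \<one>\<^bsub>G\<^esub>" by auto
qed

text \<open>For a nonzero row the first nonzero entry must come after \<open>e\<close>. The zero row
  has \<open>nu_star\<close> equal to m + 1, which exceeds \<open>e\<close> because e \<le>
  m.\<close>

lemma less_nu_star_iff:
  assumes x: "x \<in> carrier (row_group G n)" and "e \<le> m" and "e \<le> n"
  shows "e < nu_star G n m x \<longleftrightarrow> (\<forall>j\<in>{1..e}. x j = \<one>\<^bsub>G\<^esub>)"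
proof
  show "\<forall>j\<in>{1..e}. x j = \<one>\<^bsub>G\<^esub>" if "e < nu_star G n m x"
    using nu_star_greaterD[OF that] \<open>e \<le> n\<close> by auto
  show "e < nu_star G n m x" if "\<forall>j\<in>{1..e}. x j = \<one>\<^bsub>G\<^esub>"
    using that mu_star_mem[OF x] \<open>e \<le> m\<close> by (auto simp: nu_star_def not_le[symmetric])
qed

text \<open>A crude bound covering both cases of \<open>nu_star\<close>; it provides the
  \<open>M\<close> of \<open>net_poly_factor\<close>.\<close>

lemma nu_star_le:
  assumes "x \<in> carrier (row_group G n)"
  shows "nu_star G n m x \<le> n + m + 1"
  using mu_star_mem[OF assms] by (auto simp: nu_star_def)

section \<open>Equidistribution of a subgroup\<close>

lemma restrict_eq_iff: "restrict f A = restrict g A \<longleftrightarrow> (\<forall>x\<in>A. f x = g x)"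
  by (auto simp: restrict_def fun_eq_iff)

text \<open>Finiteness and order of \<open>G\<close> are encoded in the bijection
  \<open>\<phi>\<close>; lower bounds on \<open>s\<close> and \<open>m\<close> are assumed lemma by
  lemma.\<close>

locale finite_matrix_subgroup =
  fixes G :: "('g, 'r) monoid_scheme" (structure)
    and b s m n :: nat
    and \<phi> :: "nat \<Rightarrow> 'g"
    and P :: "(nat \<Rightarrow> nat \<Rightarrow> 'g) set"
  assumes comm_group: "comm_group G"
    and b: "b \<ge> 2" and m_le_n: "m \<le> n"
    and \<phi>: "bij_betw \<phi> {..<b} (carrier G)" and \<phi>_0: "\<phi> 0 = \<one>"
    and subgroup_P: "subgroup P (matrix_group G s n)" and card_P: "card P = b ^ m"
begin

lemma group_G: "group G"
  using comm_group by (rule comm_group.axioms(2))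

lemma group_rows: "group (row_group G n)"
  unfolding row_group_def by (intro product_group group_G)

lemma group_matrices: "group (matrix_group G s n)"
  unfolding matrix_group_def by (intro product_group group_rows)

lemma finite_P: "finite P"
  using card_P b by (intro card_ge_0_finite) simp

lemma carrier_matrix: "X \<in> P \<Longrightarrow> X \<in> carrier (matrix_group G s n)"
  using subgroup.subset[OF subgroup_P] by blast

lemma row_in: "X \<in> P \<Longrightarrow> i \<in> {1..s} \<Longrightarrow> X i \<in> carrier (row_group G n)"
  using carrier_matrix[of X] by (simp add: matrix_group_def PiE_iff)

lemma entry_in: "X \<in> P \<Longrightarrow> i \<in> {1..s} \<Longrightarrow> j \<in> {1..n} \<Longrightarrow> X i j \<in> carrier G"
  using row_in[of X i] by (simp add: row_group_def PiE_iff)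

lemma one_in: "\<one>\<^bsub>matrix_group G s n\<^esub> \<in> P"
  using subgroup.one_closed[OF subgroup_P] .

lemma one_entry: "i \<in> {1..s} \<Longrightarrow> j \<in> {1..n} \<Longrightarrow> \<one>\<^bsub>matrix_group G s n\<^esub> i j = \<one>"
  by (simp add: matrix_group_def row_group_def)

lemma matrix_eqI:
  assumes "X \<in> P" "Y \<in> P" and "\<And>i j. i \<in> {1..s} \<Longrightarrow> j \<in> {1..n} \<Longrightarrow> X i j = Y i j"
  shows "X = Y"
proof (rule extensionalityI)
  show "X \<in> extensional {1..s}" "Y \<in> extensional {1..s}"
    using assms(1,2)[THEN carrier_matrix] by (simp_all add: matrix_group_def PiE_def)
  show "X i = Y i" if "i \<in> {1..s}" for i
  proof (rule extensionalityI)
    show "X i \<in> extensional {1..n}" "Y i \<in> extensional {1..n}"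
      using row_in[OF assms(1) that] row_in[OF assms(2) that] by (simp_all add: row_group_def PiE_def)
  qed (use assms(3) that in auto)
qed

lemma quotient_entry:
  assumes "X \<in> P" "Y \<in> P" "i \<in> {1..s}" "j \<in> {1..n}"
  shows "(inv\<^bsub>matrix_group G s n\<^esub> X \<otimes>\<^bsub>matrix_group G s n\<^esub> Y) i j = inv (X i j) \<otimes> Y i j"
proof -
  have "inv\<^bsub>matrix_group G s n\<^esub> X = (\<lambda>i\<in>{1..s}. inv\<^bsub>row_group G n\<^esub> X i)"
    using carrier_matrix[OF assms(1)] group_rows unfolding matrix_group_def by (intro inv_product_group) auto
  moreover have "inv\<^bsub>row_group G n\<^esub> X i = (\<lambda>j\<in>{1..n}. inv (X i j))"
    using row_in[OF assms(1,3)] group_G unfolding row_group_def by (intro inv_product_group) auto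
  ultimately show ?thesis
    using assms(3,4) by (simp add: matrix_group_def row_group_def)
qed

section \<open>Digits, boxes and kernels of projections\<close>

definition digit :: "(nat \<Rightarrow> nat \<Rightarrow> 'g) \<Rightarrow> nat \<Rightarrow> nat \<Rightarrow> nat" where
  "digit X i j = inv_into {..<b} \<phi> (X i j)"

lemma digit_less:
  assumes "X \<in> P" "i \<in> {1..s}" "j \<in> {1..n}"
  shows "digit X i j < b"
  using inv_into_into[of "X i j" \<phi> "{..<b}"] entry_in[OF assms] \<phi>
  by (simp add: digit_def bij_betw_def)

lemma digit_eq_iff:
  assumes "X \<in> P" "Y \<in> P" "i \<in> {1..s}" "j \<in> {1..n}"
  shows "digit X i j = digit Y i j \<longleftrightarrow> X i j = Y i j"
  using inv_into_injective[of "{..<b}" \<phi> "X i j" "Y i j"] entry_in assms \<phi>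
  by (auto simp: digit_def bij_betw_def)

lemma digit_one: "i \<in> {1..s} \<Longrightarrow> j \<in> {1..n} \<Longrightarrow> digit \<one>\<^bsub>matrix_group G s n\<^esub> i j = 0"
  using \<phi> b unfolding digit_def
  by (simp add: one_entry bij_betw_def inv_into_f_eq \<phi>_0)

text \<open>For d i \<le> n this is the index \<open>a\<close> of the elementary interval of shape
  \<open>d\<close> that contains the point of \<open>X\<close>.\<close>

definition box :: "(nat \<Rightarrow> nat) \<Rightarrow> (nat \<Rightarrow> nat \<Rightarrow> 'g) \<Rightarrow> nat \<Rightarrow> nat" where
  "box d X = (\<lambda>i\<in>{1..s}. leading_value b (digit X i) (d i))"

definition boxes :: "(nat \<Rightarrow> nat) \<Rightarrow> (nat \<Rightarrow> nat) set" where
  "boxes d = (\<Pi>\<^sub>E i\<in>{1..s}. {..<b ^ d i})"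

text \<open>The kernel of the projection of \<open>P\<close> to the first \<open>d i\<close> entries
  of each row; for d i \<le> n it is also the fibre of \<open>box d\<close> through the
  identity.\<close>

definition vanishing :: "(nat \<Rightarrow> nat) \<Rightarrow> (nat \<Rightarrow> nat \<Rightarrow> 'g) set" where
  "vanishing d = {X \<in> P. \<forall>i\<in>{1..s}. \<forall>j\<in>{1..d i}. X i j = \<one>}"

lemma box_eq_iff:
  assumes "\<forall>i\<in>{1..s}. d i \<le> n" and "X \<in> P" "Y \<in> P"
  shows "box d X = box d Y \<longleftrightarrow> (\<forall>i\<in>{1..s}. \<forall>j\<in>{1..d i}. X i j = Y i j)"
proof -
  have "leading_value b (digit X i) (d i) = leading_value b (digit Y i) (d i)
      \<longleftrightarrow> (\<forall>j\<in>{1..d i}. X i j = Y i j)" if "i \<in> {1..s}" for i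
  proof -
    have "leading_value b (digit X i) (d i) = leading_value b (digit Y i) (d i)
      \<longleftrightarrow> (\<forall>j\<in>{1..d i}. digit X i j = digit Y i j)"
      using bspec[OF assms(1) that] assms(2,3) that by (intro leading_value_eq_iff digit_less) auto
    also have "\<dots> \<longleftrightarrow> (\<forall>j\<in>{1..d i}. X i j = Y i j)"
      using bspec[OF assms(1) that] assms(2,3) that by (intro ball_cong refl digit_eq_iff) auto
    finally show ?thesis .
  qed
  moreover have "box d X = box d Y \<longleftrightarrow>
      (\<forall>i\<in>{1..s}. leading_value b (digit X i) (d i) = leading_value b (digit Y i) (d i))"
    unfolding box_def by (rule restrict_eq_iff)
  ultimately show ?thesis by simp
qed

lemma box_mem:
  assumes "\<forall>i\<in>{1..s}. d i \<le> n" and "X \<in> P"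
  shows "box d X \<in> boxes d"
  unfolding box_def boxes_def
proof (rule restrict_PiE_iff[THEN iffD2], rule ballI)
  fix i assume i: "i \<in> {1..s}"
  then show "leading_value b (digit X i) (d i) \<in> {..<b ^ d i}"
    using bspec[OF assms(1) i] by (simp, intro leading_value_less digit_less assms(2)) auto
qed

lemma box_one:
  assumes "\<forall>i\<in>{1..s}. d i \<le> n"
  shows "box d \<one>\<^bsub>matrix_group G s n\<^esub> = (\<lambda>i\<in>{1..s}. 0)"
proof -
  have "leading_value b c k = 0" if "\<forall>j\<in>{1..k}. c j = 0" for c k
    using that by (induction k) auto
  moreover have "digit \<one>\<^bsub>matrix_group G s n\<^esub> i j = 0" if "i \<in> {1..s}" "j \<in> {1..d i}" for i j
    using bspec[OF assms that(1)] that by (intro digit_one) auto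
  ultimately show ?thesis
    unfolding box_def by (intro restrict_ext) blast
qed

lemma vanishing_eq:
  assumes "\<forall>i\<in>{1..s}. d i \<le> n"
  shows "vanishing d = {X \<in> P. box d X = box d \<one>\<^bsub>matrix_group G s n\<^esub>}"
proof -
  have "\<one>\<^bsub>matrix_group G s n\<^esub> i j = \<one>" if "i \<in> {1..s}" "j \<in> {1..d i}" for i j
    using bspec[OF assms that(1)] that by (intro one_entry) auto
  then show ?thesis
    unfolding vanishing_def by (intro Collect_cong conj_cong refl) (simp add: box_eq_iff[OF assms _ one_in])
qed

text \<open>The digits need not respect the group operation, but equality of boxes means equality of
  leading entries, which can be tested on the quotient of \<open>X\<close> and \<open>Y\<close>. So
  \<open>card_fibres\<close> applies.\<close>

lemma box_fibres:
  assumes d: "\<forall>i\<in>{1..s}. d i \<le> n"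
  shows card_box_fibre: "\<And>a. a \<in> box d ` P \<Longrightarrow> card {X \<in> P. box d X = a} = card (vanishing d)"
    and card_boxes_hit: "b ^ m = card (box d ` P) * card (vanishing d)"
proof -
  let ?M = "matrix_group G s n"
  interpret M: group ?M by (rule group_matrices)
  interpret G: group G by (rule group_G)
  have f: "box d X = box d Y \<longleftrightarrow> box d (inv\<^bsub>?M\<^esub> X \<otimes>\<^bsub>?M\<^esub> Y) = box d \<one>\<^bsub>?M\<^esub>"
    if "X \<in> P" "Y \<in> P" for X Y
  proof -
    have in_P: "inv\<^bsub>?M\<^esub> X \<otimes>\<^bsub>?M\<^esub> Y \<in> P"
      using that subgroup.m_closed[OF subgroup_P] subgroup.m_inv_closed[OF subgroup_P] by blast
    have "X i j = Y i j \<longleftrightarrow> (inv\<^bsub>?M\<^esub> X \<otimes>\<^bsub>?M\<^esub> Y) i j = \<one>\<^bsub>?M\<^esub> i j" if "i \<in> {1..s}" "j \<in> {1..n}" for i j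
      unfolding quotient_entry[OF \<open>X \<in> P\<close> \<open>Y \<in> P\<close> that] one_entry[OF that]
      using entry_in[OF \<open>X \<in> P\<close> that] entry_in[OF \<open>Y \<in> P\<close> that]
      by (auto simp: G.inv_solve_left')
    moreover have "j \<in> {1..n}" if "i \<in> {1..s}" "j \<in> {1..d i}" for i j
      using bspec[OF d that(1)] that(2) by auto
    ultimately show ?thesis
      unfolding box_eq_iff[OF d that] box_eq_iff[OF d in_P one_in] by (intro ball_cong refl) blast
  qed
  show "card {X \<in> P. box d X = a} = card (vanishing d)" if "a \<in> box d ` P" for a
    unfolding vanishing_eq[OF d] by (rule M.card_fibre[where f = "box d", OF subgroup_P finite_P f that])
  show "b ^ m = card (box d ` P) * card (vanishing d)"
    unfolding vanishing_eq[OF d] card_P[symmetric]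
    by (rule M.card_fibres_mult[where f = "box d", OF subgroup_P finite_P f])
qed

lemma card_boxes: "card (boxes d) = b ^ (\<Sum>i=1..s. d i)"
  by (simp add: boxes_def card_PiE power_sum)

lemma finite_boxes: "finite (boxes d)"
  by (auto simp: boxes_def intro: finite_PiE)

lemma index_bound:
  fixes d :: "nat \<Rightarrow> nat"
  assumes "(\<Sum>i=1..s. d i) \<le> m" and "i \<in> {1..s}"
  shows "d i \<le> m"
  using member_le_sum[of i "{1..s}" d] assms by simp

lemma indices_le_n:
  fixes d :: "nat \<Rightarrow> nat"
  assumes "(\<Sum>i=1..s. d i) \<le> m"
  shows "\<forall>i\<in>{1..s}. d i \<le> n"
  using index_bound[OF assms] m_le_n le_trans by blast

text \<open>The product of the sizes of image and kernel is b^m, and the image lies among b^|d|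
  boxes. So the kernel is smallest exactly when every box is hit.\<close>

lemma vanishing_bounds:
  assumes sum: "(\<Sum>i=1..s. d i) \<le> m"
  shows card_vanishing_ge: "b ^ (m - (\<Sum>i=1..s. d i)) \<le> card (vanishing d)"
    and card_vanishing_eq_iff: "card (vanishing d) = b ^ (m - (\<Sum>i=1..s. d i)) \<longleftrightarrow> box d ` P = boxes d"
proof -
  let ?k = "\<Sum>i=1..s. d i"
  have d: "\<forall>i\<in>{1..s}. d i \<le> n"
    using sum by (rule indices_le_n)
  have sub: "box d ` P \<subseteq> boxes d" using box_mem[OF d] by blast
  then have le: "card (box d ` P) \<le> b ^ ?k"
    using card_mono[OF finite_boxes] by (metis card_boxes)
  have eq: "b ^ ?k * b ^ (m - ?k) = card (box d ` P) * card (vanishing d)"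
    using card_boxes_hit[OF d] sum by (simp flip: power_add)
  have "b ^ ?k * b ^ (m - ?k) \<le> b ^ ?k * card (vanishing d)"
    unfolding eq using le by (rule mult_le_mono1)
  then show "b ^ (m - ?k) \<le> card (vanishing d)" using b by simp
  show "card (vanishing d) = b ^ (m - ?k) \<longleftrightarrow> box d ` P = boxes d"
  proof
    assume "card (vanishing d) = b ^ (m - ?k)"
    then have "card (box d ` P) = card (boxes d)" using eq b by (simp add: card_boxes)
    then show "box d ` P = boxes d" using card_subset_eq[OF finite_boxes sub] by blast
  next
    assume "box d ` P = boxes d"
    then show "card (vanishing d) = b ^ (m - ?k)" using eq b by (simp add: card_boxes)
  qed
qed

section \<open>Equidistribution at level k\<close>

definition equidistributed :: "nat \<Rightarrow> bool" where
  "equidistributed k \<longleftrightarrow> (\<forall>d. (\<Sum>i=1..s. d i) = k \<longrightarrow> card (vanishing d) = b ^ (m - k))"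

lemma equidistributed_0: "equidistributed 0"
  by (auto simp: equidistributed_def vanishing_def card_P)

text \<open>Every box of shape \<open>d\<close> contains a box of the shape refined by one digit in
  the first row. The smaller box is hit, hence so is the larger.\<close>

lemma equidistributed_Suc:
  assumes "equidistributed (Suc k)" and "Suc k \<le> m" and "s \<ge> 1"
  shows "equidistributed k"
  unfolding equidistributed_def
proof (intro allI impI)
  fix d assume k: "(\<Sum>i=1..s. d i) = k"
  define d' where "d' = d(1 := Suc (d 1))"
  have k': "(\<Sum>i=1..s. d' i) = Suc k"
    using k assms(3) by (simp add: d'_def sum.atLeast_Suc_atMost)
  then have full: "box d' ` P = boxes d'"
    using assms(1,2) card_vanishing_eq_iff[of d'] by (simp add: equidistributed_def)
  have "boxes d \<subseteq> box d ` P"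
  proof
    fix a assume a: "a \<in> boxes d"
    \<comment> \<open>Appending the digit 0 selects one of the \<open>b\<close> boxes into which
      \<open>a\<close> splits.\<close>
    define a' where "a' = a(1 := b * a 1)"
    have "a' \<in> boxes d'"
      using a assms(3) b by (auto simp: boxes_def a'_def d'_def PiE_iff extensional_def)
    then have "a' \<in> box d' ` P" by (simp only: full)
    then obtain X where X: "X \<in> P" "box d' X = a'" by auto
    have "box d X i = a i" if i: "i \<in> {1..s}" for i
    proof (cases "i = 1")
      case True
      have "digit X 1 (Suc (d 1)) < b"
        using index_bound[of d' 1] k' assms(2,3) m_le_n
        by (intro digit_less X(1)) (auto simp: d'_def)
      moreover have "b * leading_value b (digit X 1) (d 1) + digit X 1 (Suc (d 1)) = b * a 1"
        using fun_cong[OF X(2), of 1] assms(3) by (simp add: box_def d'_def a'_def)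
      \<comment> \<open>Division by \<open>b\<close> drops the appended digit.\<close>
      then have "(b * leading_value b (digit X 1) (d 1) + digit X 1 (Suc (d 1))) div b = a 1"
        using b by simp
      ultimately show ?thesis using True i by (simp add: box_def)
    next
      case False
      then show ?thesis using fun_cong[OF X(2), of i] i by (simp add: box_def d'_def a'_def)
    qed
    then have "box d X = a"
      using a by (intro extensionalityI[of _ "{1..s}"]) (auto simp: box_def boxes_def PiE_def)
    then show "a \<in> box d ` P" using X(1) by blast
  qed
  moreover have "box d ` P \<subseteq> boxes d"
  proof -
    have "\<forall>i\<in>{1..s}. d i \<le> n"
      using k assms(2) by (intro indices_le_n) simp
    then show ?thesis using box_mem by blast
  qed
  ultimately show "card (vanishing d) = b ^ (m - k)"
    using card_vanishing_eq_iff[of d] k assms(2) by auto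
qed

lemma equidistributed_mono:
  assumes "equidistributed k" and "j \<le> k" and "k \<le> m" and "s \<ge> 1"
  shows "equidistributed j"
  using assms(2,1,3) by (induction j rule: inc_induct) (auto intro: equidistributed_Suc assms(4))

section \<open>From boxes to nets\<close>

lemma digit_point_in_interval_iff:
  assumes "\<forall>i\<in>{1..s}. d i \<le> n" and "X \<in> P"
  shows "digit_point \<phi> b s n X \<in> elementary_interval b s d a \<longleftrightarrow> box d X = (\<lambda>i\<in>{1..s}. a i)"
proof -
  have "digit_point \<phi> b s n X \<in> elementary_interval b s d a \<longleftrightarrow>
    (\<forall>i\<in>{1..s}. (\<Sum>j=1..n. real (digit X i j) / real b ^ j)
       \<in> {real (a i) / real b ^ d i ..< (real (a i) + 1) / real b ^ d i})"
    unfolding digit_point_def elementary_interval_def digit_def by (rule restrict_PiE_iff)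
  also have "\<dots> \<longleftrightarrow> (\<forall>i\<in>{1..s}. leading_value b (digit X i) (d i) = a i)"
    using b assms by (intro ball_cong refl digit_sum_in_interval_iff digit_less) auto
  also have "\<dots> \<longleftrightarrow> box d X = (\<lambda>i\<in>{1..s}. a i)"
    unfolding box_def by (rule restrict_eq_iff[symmetric])
  finally show ?thesis .
qed

lemma inj_digit_point: "inj_on (digit_point \<phi> b s n) P"
proof (rule inj_onI)
  fix X Y assume XY: "X \<in> P" "Y \<in> P" "digit_point \<phi> b s n X = digit_point \<phi> b s n Y"
  \<comment> \<open>At depth \<open>n\<close> in every row the box determines all entries of the
    matrix.\<close>
  let ?a = "box (\<lambda>_. n) X"
  have "restrict ?a {1..s} = ?a" by (simp only: box_def restrict_restrict Int_absorb)
  then have "box (\<lambda>_. n) Y = ?a"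
    using digit_point_in_interval_iff[of "\<lambda>_. n" X ?a] digit_point_in_interval_iff[of "\<lambda>_. n" Y ?a] XY
    by simp
  then show "X = Y"
    using XY(1,2) by (intro matrix_eqI) (auto simp: box_eq_iff)
qed

lemma digit_point_unit_cube:
  assumes "X \<in> P"
  shows "digit_point \<phi> b s n X \<in> (\<Pi>\<^sub>E i\<in>{1..s}. {0..<1})"
proof -
  \<comment> \<open>The unit cube is the only elementary interval of shape 0.\<close>
  have "digit_point \<phi> b s n X \<in> elementary_interval b s (\<lambda>_. 0) (\<lambda>_. 0)"
    using assms by (subst digit_point_in_interval_iff) (auto simp: box_def)
  then show ?thesis by (simp add: elementary_interval_def)
qed

lemma card_points_in_interval:
  assumes "\<forall>i\<in>{1..s}. d i \<le> n"
  shows "card (digit_point \<phi> b s n ` P \<inter> elementary_interval b s d a)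
    = card {X \<in> P. box d X = (\<lambda>i\<in>{1..s}. a i)}"
proof -
  have "digit_point \<phi> b s n ` P \<inter> elementary_interval b s d a
    = digit_point \<phi> b s n ` {X \<in> P. box d X = (\<lambda>i\<in>{1..s}. a i)}"
    using digit_point_in_interval_iff[OF assms] by auto
  then show ?thesis
    by (simp only:) (intro card_image inj_on_subset[OF inj_digit_point], auto)
qed

text \<open>The intervals at the origin contain exactly the points of the kernels, as
  \<open>\<phi> 0\<close> is the identity. Conversely, kernels of minimal size force every box to be
  hit, and nonempty fibres are all as large as the kernel.\<close>

lemma digital_net_iff:
  "digital_net G \<phi> b n t m s P \<longleftrightarrow> t \<le> m \<and> equidistributed (m - t)"
proof (cases "t \<le> m")
  case True
  have "(\<forall>d a. (\<Sum>i=1..s. d i) = m - t \<and> (\<forall>i\<in>{1..s}. a i < b ^ d i) \<longrightarrow>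
      card (digit_point \<phi> b s n ` P \<inter> elementary_interval b s d a) = b ^ t)
    \<longleftrightarrow> equidistributed (m - t)" (is "?L \<longleftrightarrow> ?R")
  proof
    assume L: ?L
    show ?R
      unfolding equidistributed_def
    proof (intro allI impI)
      fix d assume k: "(\<Sum>i=1..s. d i) = m - t"
      then have d: "\<forall>i\<in>{1..s}. d i \<le> n"
        by (intro indices_le_n) simp
      have "card (digit_point \<phi> b s n ` P \<inter> elementary_interval b s d (\<lambda>_. 0)) = b ^ t"
        using L k b by simp
      then show "card (vanishing d) = b ^ (m - (m - t))"
        using True by (simp add: card_points_in_interval[OF d] vanishing_eq[OF d] box_one[OF d])
    qed
  next
    assume R: ?R
    show ?L
    proof (intro allI impI, elim conjE)
      fix d a assume k: "(\<Sum>i=1..s. d i) = m - t" and a: "\<forall>i\<in>{1..s}. a i < b ^ d i"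
      from k have d: "\<forall>i\<in>{1..s}. d i \<le> n"
        by (intro indices_le_n) simp
      have card: "card (vanishing d) = b ^ (m - (\<Sum>i=1..s. d i))"
        using R k by (simp add: equidistributed_def)
      then have "(\<lambda>i\<in>{1..s}. a i) \<in> box d ` P"
        using a k card_vanishing_eq_iff[of d] by (simp add: boxes_def)
      then show "card (digit_point \<phi> b s n ` P \<inter> elementary_interval b s d a) = b ^ t"
        using card k True by (simp add: card_points_in_interval[OF d] card_box_fibre[OF d])
    qed
  qed
  then show ?thesis
    using True subgroup_P finite_P digit_point_unit_cube
    unfolding digital_net_def is_net_def by (auto simp: card_image[OF inj_digit_point] card_P)
next
  case False
  then show ?thesis by (simp add: digital_net_def is_net_def)
qed

section \<open>Signs of the coefficients\<close>

lemma nu_count_eq: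
  assumes "\<forall>i\<in>{1..s}. e i \<le> m"
  shows "nu_count G n m s P e = card (vanishing e)"
proof -
  have "e i < nu_star G n m (X i) \<longleftrightarrow> (\<forall>j\<in>{1..e i}. X i j = \<one>)" if "X \<in> P" "i \<in> {1..s}" for X i
    using bspec[OF assms that(2)] m_le_n by (intro less_nu_star_iff row_in that) auto
  then show ?thesis
    unfolding nu_count_def vanishing_def by (intro arg_cong[where f = card] Collect_cong) auto
qed

lemma one_in_vanishing:
  assumes "\<forall>i\<in>{1..s}. d i \<le> n"
  shows "\<one>\<^bsub>matrix_group G s n\<^esub> \<in> vanishing d"
  by (simp add: vanishing_eq[OF assms] one_in)

text \<open>As m \<le> s * m, the exponent s * m - |e| splits into s * m - m and m - |e|, which
  exposes the common factor.\<close>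

lemma excess_le_m:
  assumes sum: "(\<Sum>i=1..s. e i) \<le> m" and "s \<ge> 1"
  shows "excess G b n m s P e
    = int b ^ (s * m - m) * (int (card (vanishing e)) - int (b ^ (m - (\<Sum>i=1..s. e i))))"
proof -
  have "m \<le> s * m" using assms(2) by (cases s) auto
  then have "s * m - (\<Sum>i=1..s. e i) = (s * m - m) + (m - (\<Sum>i=1..s. e i))"
    using sum by simp
  then show ?thesis
    using nu_count_eq[of e] index_bound[OF sum]
    by (simp add: excess_def power_add algebra_simps)
qed

lemma excess_nonneg:
  assumes "(\<Sum>i=1..s. e i) \<le> m" and "s \<ge> 1"
  shows "excess G b n m s P e \<ge> 0"
  using card_vanishing_ge[OF assms(1)] unfolding excess_le_m[OF assms]
  by (intro mult_nonneg_nonneg) (simp_all flip: of_nat_power)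

lemma equidistributed_iff_excess:
  assumes "k \<le> m" and "s \<ge> 1"
  shows "equidistributed k \<longleftrightarrow> (\<forall>e. (\<Sum>i=1..s. e i) = k \<longrightarrow> excess G b n m s P e = 0)"
proof -
  have "excess G b n m s P e = 0 \<longleftrightarrow> card (vanishing e) = b ^ (m - k)" if "(\<Sum>i=1..s. e i) = k" for e
    using excess_le_m[of e] that assms b by (simp flip: of_nat_power)
  then show ?thesis unfolding equidistributed_def by auto
qed

text \<open>The kernel contains the identity, so the first term is at least b^(s * m - m), while the
  subtracted one is b^(s * m - m - 1), or 0 if some \<open>e i\<close> exceeds
  \<open>m\<close>.\<close>

lemma excess_Suc_m:
  assumes sum: "(\<Sum>i=1..s. e i) = Suc m" and s: "s \<ge> 2" and m: "m \<ge> 1"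
  shows "excess G b n m s P e \<ge> 0"
    and "\<forall>i\<in>{1..s}. e i \<le> m \<Longrightarrow> excess G b n m s P e > 0"
proof -
  have pos: "excess G b n m s P e > 0" if e: "\<forall>i\<in>{1..s}. e i \<le> m"
  proof -
    have "2 * m \<le> s * m" using s by simp
    \<comment> \<open>With truncated subtraction strictness requires s * m > m, hence two rows and m
      \<ge> 1.\<close>
    then have "s * m - Suc m < s * m - m" using m by linarith
    then have "int b ^ (s * m - Suc m) < int b ^ (s * m - m)"
      using b by (intro power_strict_increasing) auto
    also have "\<dots> \<le> int b ^ (s * m - m) * int (card (vanishing e))"
    proof -
      have "finite (vanishing e)" using finite_P by (simp add: vanishing_def)
      then have "card (vanishing e) > 0"
        using one_in_vanishing[of e] e m_le_n by (auto simp: card_gt_0_iff intro: order_trans)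
      then have "int 1 \<le> int (card (vanishing e))" by (subst of_nat_le_iff) simp
      then have "int b ^ (s * m - m) * int 1 \<le> int b ^ (s * m - m) * int (card (vanishing e))"
        by (intro mult_left_mono) auto
      then show ?thesis by simp
    qed
    finally show ?thesis
      unfolding excess_def nu_count_eq[OF e] sum using e by simp
  qed
  then show "\<forall>i\<in>{1..s}. e i \<le> m \<Longrightarrow> excess G b n m s P e > 0" .
  show "excess G b n m s P e \<ge> 0"
  proof (cases "\<forall>i\<in>{1..s}. e i \<le> m")
    case True
    then show ?thesis using pos by simp
  next
    case False
    then show ?thesis unfolding excess_def by (simp only: if_False) simp
  qed
qed

text \<open>If e 1 > m, the subtracted term is absent, and a matrix counted by N(e) would have
  \<open>m\<close> leading zeros. Full equidistribution leaves only the identity, whose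
  \<open>nu_star\<close> m + 1 does not exceed \<open>e 1\<close>.\<close>

lemma excess_one_row:
  assumes s: "s = 1" and full: "equidistributed m"
  shows "excess G b n m s P e = 0"
proof (cases "e 1 \<le> m")
  case True
  then have "equidistributed (e 1)" using equidistributed_mono[OF full] s by simp
  then show ?thesis using equidistributed_iff_excess[of "e 1"] True s by simp
next
  case False
  have row_index: "{1..s} = {1}" using s by simp
  have sum_one: "(\<Sum>i=1..s. d i) = d 1" for d :: "nat \<Rightarrow> nat"
    unfolding row_index by simp
  have "card (vanishing (\<lambda>_. m)) = 1"
    using full unfolding equidistributed_def sum_one by simp
  then obtain Z where Z: "vanishing (\<lambda>_. m) = {Z}" by (rule card_1_singletonE)
  have one: "vanishing (\<lambda>_. m) = {\<one>\<^bsub>matrix_group G s n\<^esub>}"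
    using one_in_vanishing[of "\<lambda>_. m"] m_le_n unfolding Z by simp
  have "\<not> e 1 < nu_star G n m (X 1)" if X: "X \<in> P" for X
  proof
    assume less: "e 1 < nu_star G n m (X 1)"
    then have "X \<in> vanishing (\<lambda>_. m)"
      unfolding vanishing_def row_index using nu_star_greaterD[OF less] False X m_le_n by auto
    then have "X = \<one>\<^bsub>matrix_group G s n\<^esub>" using one by simp
    then have "X 1 = \<one>\<^bsub>row_group G n\<^esub>" using s by (simp add: matrix_group_def)
    then show False using less False by (simp add: nu_star_def)
  qed
  then have "{X \<in> P. \<forall>i\<in>{1..s}. e i < nu_star G n m (X i)} = {}" using s by auto
  then have "nu_count G n m s P e = 0" unfolding nu_count_def by (simp only: card.empty)
  then show ?thesis using False s by (simp add: excess_def)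
qed

section \<open>The degree and the strict value of t\<close>

lemma net_poly_eq:
  "net_poly G b n m s P = (1 - fls_X) ^ s *
    (\<Sum>e\<in>{1..s} \<rightarrow>\<^sub>E {..<n + m + 1}. of_int (excess G b n m s P e)
        * fls_X_intpow (int (s * m) - int (\<Sum>i=1..s. e i)))"
  by (rule net_poly_factor[OF finite_P]) (simp, intro nu_star_le row_in)

text \<open>Above the exponent s * m - (k + 1) all terms of the cofactor vanish; at it they are
  nonnegative and one is positive, so nothing cancels. The power of 1 - z adds \<open>s\<close> to
  the degree.\<close>

lemma laurent_degree_net_poly:
  assumes vanish: "\<And>e. (\<Sum>i=1..s. e i) \<le> k \<Longrightarrow> excess G b n m s P e = 0"
    and nonneg: "\<And>e. (\<Sum>i=1..s. e i) = Suc k \<Longrightarrow> excess G b n m s P e \<ge> 0"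
    and e: "(\<Sum>i=1..s. e i) = Suc k" "excess G b n m s P e > 0" "\<forall>i\<in>{1..s}. e i \<le> m"
  shows "laurent_degree (net_poly G b n m s P) = int (s * m) - int (Suc k) + int s"
  unfolding net_poly_eq
proof (rule laurent_degree_one_minus_X_power)
  let ?E = "{1..s} \<rightarrow>\<^sub>E {..<n + m + 1}"
  let ?R = "\<Sum>e\<in>?E. of_int (excess G b n m s P e) * fls_X_intpow (int (s * m) - int (\<Sum>i=1..s. e i)) :: int fls"
  have fin: "finite ?E" by (intro finite_PiE) auto
  \<comment> \<open>The index set contains only extensional functions; \<open>excess\<close> depends
    only on the values on \<open>{1..s}\<close>.\<close>
  define e' where "e' = restrict e {1..s}"
  have "(\<Sum>e | e \<in> ?E \<and> int (\<Sum>i=1..s. e i) = int (Suc k). excess G b n m s P e) > 0"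
  proof (rule sum_pos2)
    show "e' \<in> {e \<in> ?E. int (\<Sum>i=1..s. e i) = int (Suc k)}"
      using e(1,3) by (force simp: e'_def restrict_PiE_iff)
    have "excess G b n m s P e' = excess G b n m s P e"
      by (simp add: excess_def nu_count_def e'_def)
    then show "0 < excess G b n m s P e'" using e(2) by simp
    show "0 \<le> excess G b n m s P e" if "e \<in> {e \<in> ?E. int (\<Sum>i=1..s. e i) = int (Suc k)}" for e
      using that by (intro nonneg) (simp only: mem_Collect_eq of_nat_eq_iff)
  qed (use fin in simp)
  then show "fls_nth ?R (int (s * m) - int (Suc k)) \<noteq> 0"
    unfolding net_poly_factor_nth by simp
  show "fls_nth ?R q = 0" if "q > int (s * m) - int (Suc k)" for q
  proof -
    define k' where "k' = int (s * m) - q"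
    have "fls_nth ?R q = fls_nth ?R (int (s * m) - k')" by (simp add: k'_def)
    also have "\<dots> = 0"
      unfolding net_poly_factor_nth using that by (intro sum.neutral ballI vanish) (auto simp: k'_def simp del: of_nat_sum)
    finally show ?thesis .
  qed
qed

text \<open>With \<open>k\<close> the greatest equidistributed level, the least \<open>t\<close> is
  m - k. Outside the case s = 1, k = m the degree is s * m - (k + 1) + s, and adding (1 - s)(m + 1)
  leaves m - k.\<close>

lemma strict_digital_net_degree:
  assumes s: "s \<ge> 1" and m: "m \<ge> 1"
  shows "\<exists>t. strict_digital_net G \<phi> b n t m s P \<and>
           int t = (1 - int s) * (int m + 1) + laurent_degree (net_poly G b n m s P)"
proof -
  define k where "k = (GREATEST k. k \<le> m \<and> equidistributed k)"
  have k: "k \<le> m" "equidistributed k"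
    using GreatestI_nat[of "\<lambda>k. k \<le> m \<and> equidistributed k" 0 m] equidistributed_0
    by (auto simp: k_def)
  have greatest: "j \<le> k" if "j \<le> m" "equidistributed j" for j
    unfolding k_def using that by (intro Greatest_le_nat[where b = m]) auto
  have "strict_digital_net G \<phi> b n (m - k) m s P"
    unfolding strict_digital_net_def digital_net_iff
  proof (intro conjI allI impI)
    show "equidistributed (m - (m - k))" using k by simp
    show "m - k \<le> t" if "t \<le> m \<and> equidistributed (m - t)" for t
      using greatest[of "m - t"] that by simp
  qed simp
  moreover have "int (m - k) = (1 - int s) * (int m + 1) + laurent_degree (net_poly G b n m s P)"
  proof (cases "s = 1 \<and> k = m")
    case True
    then have "excess G b n m s P e = 0" for e
      using k by (intro excess_one_row) simp_all
    then have "net_poly G b n m s P = 0"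
      unfolding net_poly_eq by (simp only: of_int_0 mult_zero_left mult_zero_right sum.neutral_const)
    \<comment> \<open>The default degree 0 of the zero polynomial fits: both 1 - s and m - k are
      0.\<close>
    with True show ?thesis by (simp add: laurent_degree_def)
  next
    case False
    have vanish: "excess G b n m s P e = 0" if "(\<Sum>i=1..s. e i) \<le> k" for e
      using equidistributed_iff_excess[of "\<Sum>i=1..s. e i"] equidistributed_mono[OF k(2) that k(1) s]
        that k(1) s by simp
    have "laurent_degree (net_poly G b n m s P) = int (s * m) - int (Suc k) + int s"
    proof (cases "k = m")
      case True
      with False s have s2: "s \<ge> 2" by auto
      \<comment> \<open>A vector of sum m + 1 with no entry above \<open>m\<close>, as strict
        positivity in \<open>excess_Suc_m\<close> demands; it takes a second row.\<close>
      define e :: "nat \<Rightarrow> nat" where "e i = (if i = 1 then m else if i = 2 then 1 else 0)" for i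
      have "(\<Sum>i=1..s. e i) = (\<Sum>i\<in>{1, 2}. e i)"
        using s2 by (intro sum.mono_neutral_right) (auto simp: e_def)
      then have e: "(\<Sum>i=1..s. e i) = Suc m" by (simp add: e_def)
      have e_le: "e i \<le> m" for i using m by (simp add: e_def)
      show ?thesis
        using vanish excess_Suc_m[OF _ s2 m] e e_le True by (intro laurent_degree_net_poly[where e = e]) auto
    next
      case False
      with k(1) have k': "Suc k \<le> m" by simp
      then have "\<not> equidistributed (Suc k)" using greatest[of "Suc k"] by auto
      then obtain e where e: "(\<Sum>i=1..s. e i) = Suc k" "excess G b n m s P e \<noteq> 0"
        using equidistributed_iff_excess[OF k' s] by auto
      show ?thesis
      proof (rule laurent_degree_net_poly[OF vanish])
        show "excess G b n m s P e \<ge> 0" if "(\<Sum>i=1..s. e i) = Suc k" for e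
          using that k' s by (intro excess_nonneg) auto
        show "excess G b n m s P e > 0" using excess_nonneg[of e] e k' s by simp
        show "\<forall>i\<in>{1..s}. e i \<le> m" using index_bound[of e] e(1) k' by simp
      qed (use e in auto)
    qed
    then show ?thesis using k(1) by (simp add: algebra_simps of_nat_diff)
  qed
  ultimately show ?thesis by blast
qed

end

theorem theorem4:
  fixes G :: "('g, 'r) monoid_scheme"
    and b s m n :: nat
    and \<phi> :: "nat \<Rightarrow> 'g"
    and P :: "(nat \<Rightarrow> nat \<Rightarrow> 'g) set"
  assumes "comm_group G" and "finite (carrier G)" and "card (carrier G) = b"
    and "b \<ge> 2" and "s \<ge> 1" and "m \<ge> 1" and "n \<ge> m"
    and "bij_betw \<phi> {..<b} (carrier G)" and "\<phi> 0 = \<one>\<^bsub>G\<^esub>"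
    and "subgroup P (matrix_group G s n)" and "card P = b ^ m"
  shows "\<exists>t. strict_digital_net G \<phi> b n t m s P \<and>
           int t = (1 - int s) * (int m + 1) + laurent_degree (net_poly G b n m s P)"
proof -
  interpret finite_matrix_subgroup G b s m n \<phi> P
    by (rule finite_matrix_subgroup.intro) (use assms in simp_all)
  show ?thesis by (rule strict_digital_net_degree[OF assms(5,6)])
qed

end
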